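(* Let $\mathcal P$ be a countable set with a map $N:\mathcal P\to\mathbb Z_{>1}$, let $\mathcal M$ be the free abelian monoid (written additively) generated by $\mathcal P$, and extend $N$ to a monoid homomorphism $N:(\mathcal M,+)\to(\mathbb N,\cdot)$. Let $X$ be either $\mathbb Q$ or $\{q^z: z\in\mathbb Z\}$ for some integer $q>1$, with $N(\mathcal M)\subseteq X$. Assume there are constants $\kappa>0$ and $0\le\theta<1$ such that, for sufficiently large $x\in X$, $\#\{\mathfrak m\in\mathcal M: N(\mathfrak m)\le x\}=\kappa x+O(x^\theta)$. Let $h\ge2$ be an integer, and for $x\in X$ let $\mathcal S_h(x)$ be the set of $h$-free elements $\mathfrak m\in\mathcal M$ with $N(\mathfrak m)\le x$. Then for any $\epsilon>0$, the number of $\mathfrak m\in\mathcal S_h(x)$ that do not satisfy the inequality $$(1-\epsilon)\log\log N(\mathfrak m)\le\omega(\mathfrak m)\le(1+\epsilon)\log\log N(\mathfrak m)$$ is $o(|\mathcal S_h(x)|)$ as $x\to\infty$ (through $X$).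
   Context: Each $\mathfrak m\in\mathcal M$ is written uniquely as $\mathfrak m=\sum_{\mathfrak p\in\mathcal P}n_{\mathfrak p}(\mathfrak m)\,\mathfrak p$ with $n_{\mathfrak p}(\mathfrak m)\in\mathbb N\cup\{0\}$, all but finitely many equal to $0$; $N(\mathfrak m)=\prod_{\mathfrak p}N(\mathfrak p)^{n_{\mathfrak p}(\mathfrak m)}$. $\omega(\mathfrak m)$ is the number of $\mathfrak p\in\mathcal P$ with $n_{\mathfrak p}(\mathfrak m)\ge1$. The element $\mathfrak m$ is $h$-free if $n_{\mathfrak p}(\mathfrak m)\le h-1$ for all $\mathfrak p$. The element $0$ (of norm $1$, where $\log\log N$ is undefined) is disregarded. *)

theory Defs
  imports Complex_Main "HOL-Library.Multiset" "HOL-Library.Countable_Set" "HOL-Library.Landau_Symbols"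
begin

text \<open>
  The free abelian monoid on \<open>P\<close> consists of the finite multisets with elements in \<open>P\<close>;
  the coefficient of \<open>p\<close> in \<open>m\<close> is \<open>count m p\<close>.
\<close>

definition free_monoid :: "'a set \<Rightarrow> 'a multiset set" where
  "free_monoid P = {m. set_mset m \<subseteq> P}"

definition mnorm :: "('a \<Rightarrow> nat) \<Rightarrow> 'a multiset \<Rightarrow> nat" where
  "mnorm N m = (\<Prod>p\<in>#m. N p)"

lemma mnorm_empty [simp]: "mnorm N {#} = 1"
  and mnorm_single [simp]: "mnorm N {#p#} = N p"
  and mnorm_add: "mnorm N (m + m') = mnorm N m * mnorm N m'"
  by (simp_all add: mnorm_def)

lemma mnorm_altdef: "mnorm N m = (\<Prod>p\<in>set_mset m. N p ^ count m p)"
  by (simp add: mnorm_def image_prod_mset_multiplicity)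

definition omega :: "'a multiset \<Rightarrow> nat" where
  "omega m = card {p. count m p \<ge> 1}"

definition h_free :: "nat \<Rightarrow> 'a multiset \<Rightarrow> bool" where
  "h_free h m \<longleftrightarrow> (\<forall>p. count m p \<le> h - 1)"

definition h_free_upto :: "'a set \<Rightarrow> ('a \<Rightarrow> nat) \<Rightarrow> nat \<Rightarrow> real \<Rightarrow> 'a multiset set" where
  "h_free_upto P N h x = {m \<in> free_monoid P. h_free h m \<and> real (mnorm N m) \<le> x}"

text \<open>The filter for \<open>x \<rightarrow> \<infinity>\<close> with \<open>x\<close> restricted to \<open>X\<close>.\<close>

definition at_top_in :: "real set \<Rightarrow> real filter" where
  "at_top_in X = inf at_top (principal X)"

lemma eventually_at_top_in:
  "eventually Q (at_top_in X) \<longleftrightarrow> (\<exists>x0. \<forall>x\<in>X. x \<ge> x0 \<longrightarrow> Q x)"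
  by (auto simp: at_top_in_def eventually_inf_principal eventually_at_top_linorder)

end

theory Submission
  imports Defs
begin

text \<open>
  Write \<open>A(x)\<close> for the number of all elements of norm at most \<open>x\<close>, and \<open>S(x)\<close> for the sum
  of \<open>1 / N(p)\<close> over the generators \<open>p\<close> of norm at most \<open>x\<close> (\<open>recip_sum\<close>).  The
  \<open>h\<close>-free elements of norm at most \<open>x\<close> number at least a positive constant times \<open>x\<close>
  (\<open>card_h_free_upto_ge\<close>).  Hence it is enough to show that, among all elements of norm at
  most \<open>x\<close>, only \<open>o(x)\<close> violate the inequality.

  This is Turan's argument.  The multiples of \<open>p\<close> of norm at most \<open>x\<close> number
  \<open>A(x / N(p))\<close>, about \<open>\<kappa> x / N(p)\<close>.  Summing over \<open>p\<close>, the sum of \<open>omega m\<close> is \<open>\<kappa> x S(x)\<close>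
  to leading order; counting pairs of generators, the sum of \<open>(omega m)\<^sup>2\<close> is at most
  \<open>\<kappa> x S(x)\<^sup>2\<close> to leading order.  So the sum of \<open>(omega m - S(x))\<^sup>2\<close> is \<open>o(x S(x)\<^sup>2)\<close>
  (\<open>eventually_variance_le\<close>), and by Chebyshev's inequality \<open>omega m\<close> lies within a factor
  close to \<open>1\<close> of \<open>S(x)\<close> for all but \<open>o(x)\<close> elements.

  It remains to replace \<open>S(x)\<close> by \<open>ln (ln (N(m)))\<close> (\<open>atypical_subset\<close>).  Elements of norm at
  most \<open>sqrt x\<close> can be discarded, and for the others \<open>ln (ln (N(m)))\<close> is
  \<open>ln (ln x)\<close> up to a bounded error.  That \<open>S(x)\<close> is asymptotic to \<open>ln (ln x)\<close>
  (\<open>eventually_recip_sum_between\<close>) follows from comparing Euler products with sums over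
  elements.  From below, the sum of \<open>1 / N(m)\<close> over \<open>N(m) \<le> x\<close> is of order at least \<open>ln x\<close>
  and at most the product of \<open>1 / (1 - 1 / N(p))\<close> over \<open>N(p) \<le> x\<close>.  From above, the product
  of \<open>1 + N(p) powr - (1 + \<delta>)\<close> is a sum over squarefree elements, hence \<open>O(1 / \<delta>)\<close>; with
  \<open>\<delta> = \<eta> / ln x\<close> the extra exponent \<open>\<delta>\<close> changes the terms with \<open>N(p) \<le> x\<close> by a factor of at
  most \<open>exp \<eta>\<close>, and \<open>\<eta>\<close> is arbitrary.

  The formula for \<open>A\<close> holds at points of \<open>X\<close>.  Since \<open>X\<close> is closed under division by norms,
  it applies to \<open>A(x / N(m))\<close> for \<open>x\<close> in \<open>X\<close>; for real arguments, linear upper and lower bounds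
  suffice (\<open>asymptotic_growthI\<close>).
\<close>

section \<open>Elements, generators and norms\<close>

lemma empty_in_free_monoid [simp]: "{#} \<in> free_monoid P"
  by (simp add: free_monoid_def)

lemma add_in_free_monoid_iff [simp]:
  "m + m' \<in> free_monoid P \<longleftrightarrow> m \<in> free_monoid P \<and> m' \<in> free_monoid P"
  by (auto simp: free_monoid_def)

lemma single_in_free_monoid_iff [simp]: "{#p#} \<in> free_monoid P \<longleftrightarrow> p \<in> P"
  by (simp add: free_monoid_def)

lemma add_mset_in_free_monoid_iff [simp]:
  "add_mset p m \<in> free_monoid P \<longleftrightarrow> p \<in> P \<and> m \<in> free_monoid P"
  by (simp add: free_monoid_def)

lemma mnorm_add_mset: "mnorm N (add_mset p m) = N p * mnorm N m"
  by (simp add: mnorm_def)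

lemma mset_set_in_free_monoid: "finite T \<Longrightarrow> T \<subseteq> P \<Longrightarrow> mset_set T \<in> free_monoid P"
  by (simp add: free_monoid_def)

lemma mnorm_mset_set: "mnorm N (mset_set T) = (\<Prod>p\<in>T. N p)"
  by (simp add: mnorm_def prod_unfold_prod_mset)

lemma omega_eq_card_set_mset: "omega m = card (set_mset m)"
  unfolding omega_def by (rule arg_cong[of _ _ card]) (auto simp: Suc_le_eq)

locale normed_free_monoid =
  fixes P :: "'a set" and N :: "'a \<Rightarrow> nat"
  assumes norm_gt_1: "p \<in> P \<Longrightarrow> N p > 1"
begin

definition elts :: "real \<Rightarrow> 'a multiset set" where
  "elts x = {m \<in> free_monoid P. real (mnorm N m) \<le> x}"

definition gens :: "real \<Rightarrow> 'a set" where
  "gens x = {p \<in> P. real (N p) \<le> x}"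

definition recip_sum :: "real \<Rightarrow> real" where
  "recip_sum x = (\<Sum>p\<in>gens x. 1 / real (N p))"

lemma mnorm_ge_1: "m \<in> free_monoid P \<Longrightarrow> mnorm N m \<ge> 1"
proof (induction m)
  case (add p m)
  then have "1 \<le> N p" "1 \<le> mnorm N m" using norm_gt_1[of p] by auto
  then show ?case using mult_le_mono[of 1 "N p" 1 "mnorm N m"] by (simp add: mnorm_add_mset)
qed simp

lemma mnorm_pos: "m \<in> free_monoid P \<Longrightarrow> mnorm N m > 0"
  using mnorm_ge_1 by fastforce

lemma elts_mono: "x \<le> y \<Longrightarrow> elts x \<subseteq> elts y"
  by (auto simp: elts_def)

lemma elts_empty: "x < 1 \<Longrightarrow> elts x = {}"
  using mnorm_ge_1 by (force simp: elts_def)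

lemma empty_in_elts: "x \<ge> 1 \<Longrightarrow> {#} \<in> elts x"
  by (simp add: elts_def)

lemma single_image_gens: "(\<lambda>p. {#p#}) ` gens x \<subseteq> elts x"
  by (auto simp: gens_def elts_def)

lemma inj_single: "inj_on (\<lambda>p. {#p#}) Q"
  by (auto simp: inj_on_def)

text \<open>Translating by \<open>k\<close> is a bijection onto its multiples, which turns a count of
  multiples into a count of elements of smaller norm.\<close>

lemma multiples_eq_image:
  assumes "k \<in> free_monoid P"
  shows "{m \<in> elts x. k \<subseteq># m} = (\<lambda>m. k + m) ` elts (x / real (mnorm N k))"
proof -
  have pos: "real (mnorm N k) > 0" using mnorm_pos[OF assms] by simp
  show ?thesis
  proof (intro equalityI subsetI)
    fix m assume m: "m \<in> {m \<in> elts x. k \<subseteq># m}"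
    then obtain m' where "m = k + m'" by (auto simp: mset_subset_eq_exists_conv)
    with m pos show "m \<in> (\<lambda>m. k + m) ` elts (x / real (mnorm N k))"
      by (auto simp: elts_def mnorm_add field_simps)
  next
    fix m assume "m \<in> (\<lambda>m. k + m) ` elts (x / real (mnorm N k))"
    with pos assms show "m \<in> {m \<in> elts x. k \<subseteq># m}"
      by (auto simp: elts_def mnorm_add field_simps)
  qed
qed

lemma card_multiples:
  assumes "k \<in> free_monoid P"
  shows "card {m \<in> elts x. k \<subseteq># m} = card (elts (x / real (mnorm N k)))"
  unfolding multiples_eq_image[OF assms] by (rule card_image) (auto simp: inj_on_def)

text \<open>Expanding each factor of the Euler product as a geometric series and multiplying out
  produces \<open>1 / N(m)\<close> for every \<open>m\<close> supported on \<open>Q\<close>, so a finite set of such \<open>m\<close>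
  contributes at most the product.  The induction adds one generator \<open>p\<close> at a time:
  \<open>m\<close> is determined by the multiplicity of \<open>p\<close> and the part of \<open>m\<close> prime to \<open>p\<close>.\<close>

lemma sum_inverse_mnorm_le_euler_product:
  assumes "finite Q" "Q \<subseteq> P" "finite G" "\<And>m. m \<in> G \<Longrightarrow> set_mset m \<subseteq> Q"
  shows "(\<Sum>m\<in>G. 1 / real (mnorm N m)) \<le> (\<Prod>p\<in>Q. 1 / (1 - 1 / real (N p)))"
  using assms
proof (induction Q arbitrary: G rule: finite_induct)
  case empty
  then have "G \<subseteq> {{#}}" by auto
  then have "(\<Sum>m\<in>G. 1 / real (mnorm N m)) \<le> (\<Sum>m\<in>{{#}}. 1 / real (mnorm N m))"
    by (intro sum_mono2) auto
  then show ?case by simp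
next
  case (insert p Q)
  define G' where "G' = filter_mset (\<lambda>r. r \<noteq> p) ` G"
  define K where "K = Max (insert 0 ((\<lambda>m. count m p) ` G))"
  have Np: "real (N p) > 1" using norm_gt_1 insert.prems by auto
  have finG': "finite G'" using insert.prems by (simp add: G'_def)
  have G'Q: "set_mset m \<subseteq> Q" if "m \<in> G'" for m
    using that insert.prems(3) by (fastforce simp: G'_def)
  let ?f = "\<lambda>(k, m). replicate_mset k p + m"
  have split: "m = replicate_mset (count m p) p + filter_mset (\<lambda>r. r \<noteq> p) m" for m :: "'a multiset"
    by (rule multiset_eqI) auto
  have sub: "G \<subseteq> ?f ` ({..K} \<times> G')"
  proof
    fix m assume m: "m \<in> G"
    have "count m p \<le> K" unfolding K_def using m insert.prems(2) by (intro Max_ge) auto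
    with m have "(count m p, filter_mset (\<lambda>r. r \<noteq> p) m) \<in> {..K} \<times> G'" by (auto simp: G'_def)
    then show "m \<in> ?f ` ({..K} \<times> G')" using split[of m] by (metis (no_types, lifting) case_prod_conv imageI)
  qed
  have inj: "inj_on ?f ({..K} \<times> G')"
  proof (rule inj_onI, clarify)
    fix k m l m' assume mm: "m \<in> G'" "m' \<in> G'"
      and eq: "replicate_mset k p + m = replicate_mset l p + m'"
    have "count m p = 0" "count m' p = 0"
      using G'Q[OF mm(1)] G'Q[OF mm(2)] insert.hyps by (auto simp: count_eq_zero_iff)
    with arg_cong[OF eq, of "\<lambda>m. count m p"] have "k = l" by simp
    with eq show "k = l \<and> m = m'" by simp
  qed
  have "(\<Sum>m\<in>G. 1 / real (mnorm N m)) \<le> (\<Sum>m\<in>?f ` ({..K} \<times> G'). 1 / real (mnorm N m))"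
    by (intro sum_mono2 sub finite_imageI finite_cartesian_product finG') auto
  also have "\<dots> = (\<Sum>(k, m)\<in>{..K} \<times> G'. (1 / real (N p)) ^ k * (1 / real (mnorm N m)))"
    by (subst sum.reindex[OF inj])
      (auto intro!: sum.cong simp: mnorm_def power_one_over)
  also have "\<dots> = (\<Sum>k\<le>K. (1 / real (N p)) ^ k) * (\<Sum>m\<in>G'. 1 / real (mnorm N m))"
    by (simp add: sum_product sum.cartesian_product)
  also have "\<dots> \<le> (1 / (1 - 1 / real (N p))) * (\<Prod>p\<in>Q. 1 / (1 - 1 / real (N p)))"
  proof (intro mult_mono insert.IH finG' G'Q)
    have "(\<Sum>k\<le>K. (1 / real (N p)) ^ k) \<le> (\<Sum>k. (1 / real (N p)) ^ k)"
      using Np by (intro sum_le_suminf summable_geometric) auto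
    also have "\<dots> = 1 / (1 - 1 / real (N p))" using Np by (intro suminf_geometric) auto
    finally show "(\<Sum>k\<le>K. (1 / real (N p)) ^ k) \<le> 1 / (1 - 1 / real (N p))" .
  qed (use insert.prems Np in \<open>auto intro!: sum_nonneg\<close>)
  finally show ?case using insert.hyps by simp
qed

end

section \<open>Sums over elements when their number grows linearly\<close>

text \<open>Two-sided linear bounds on the counting function, for real arguments.  They already
  determine the reciprocal sum over the generators to leading order, and they force a
  positive proportion of the elements to be squarefree.\<close>

locale linear_growth = normed_free_monoid +
  fixes c C :: real
  assumes c_pos: "c > 0"
    and finite_elts: "finite (elts x)"
    and card_elts_ge: "y \<ge> 1 \<Longrightarrow> c * y \<le> real (card (elts y))"
    and card_elts_le: "y \<ge> 0 \<Longrightarrow> real (card (elts y)) \<le> C * y"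
begin

lemma finite_gens: "finite (gens x)"
  using finite_subset[OF single_image_gens finite_elts] finite_imageD inj_single by blast

lemma c_le_C: "c \<le> C"
  using card_elts_ge[of 1] card_elts_le[of 1] by simp

lemma C_pos: "C > 0"
  using c_pos c_le_C by simp

lemma card_gens_le: "card (gens x) \<le> card (elts x)"
  using card_mono[OF finite_elts single_image_gens] card_image[OF inj_single] by metis

lemma recip_sum_nonneg: "recip_sum x \<ge> 0"
  unfolding recip_sum_def by (intro sum_nonneg) auto

text \<open>The zeta function \<open>\<Sum>m. N(m) powr - s\<close> has at most a simple pole at \<open>s = 1\<close>.  The
  statement is about finite partial sums, uniformly, so that no convergence has to be
  discussed.  The shell \<open>exp (j - 1) < N(m) \<le> exp j\<close> contributes at most a constant times
  \<open>exp (- j * \<delta>)\<close>, and the geometric series in \<open>j\<close> has sum at most \<open>2 / \<delta>\<close>.\<close>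

lemma zeta_partial_sum_le:
  assumes \<delta>: "0 < \<delta>" "\<delta> \<le> 1" and G: "finite G" "G \<subseteq> free_monoid P"
  shows "(\<Sum>m\<in>G. real (mnorm N m) powr - (1 + \<delta>)) \<le> 2 * exp 2 * C / \<delta>"
proof -
  define w where "w j = exp (- (1 + \<delta>) * real j)" for j :: nat
  define e where "e m = nat \<lceil>ln (real (mnorm N m))\<rceil>" for m
  define J where "J = Max (insert 0 (e ` G))"
  \<comment> \<open>Only the term \<open>j = e m\<close> is needed; the other \<open>j\<close> with \<open>N(m) \<le> exp j\<close> are kept so that counting elements below \<open>exp j\<close> suffices after exchanging the sums.\<close>
  have pt: "real (mnorm N m) powr - (1 + \<delta>) \<le>
      exp 2 * (\<Sum>j\<le>J. w j * of_bool (real (mnorm N m) \<le> exp (real j)))" if m: "m \<in> G" for m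
  proof -
    have n1: "real (mnorm N m) \<ge> 1" using mnorm_ge_1 m G by fastforce
    have eJ: "e m \<le> J" unfolding J_def using m G by (intro Max_ge) auto
    have l0: "0 \<le> ln (real (mnorm N m))" using n1 by simp
    have e1: "ln (real (mnorm N m)) \<le> real (e m)" "real (e m) \<le> ln (real (mnorm N m)) + 1"
      unfolding e_def using l0 by linarith+
    have le: "real (mnorm N m) \<le> exp (real (e m))"
      using e1(1) n1 by (metis exp_le_cancel_iff exp_ln less_le_trans zero_less_one)
    have "(1 + \<delta>) * real (e m) \<le> (1 + \<delta>) * (ln (real (mnorm N m)) + 1)"
      using \<delta> e1 by (intro mult_left_mono) auto
    then have "- (1 + \<delta>) * ln (real (mnorm N m)) \<le> 2 + - (1 + \<delta>) * real (e m)"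
      using \<delta> by (simp add: algebra_simps)
    then have "real (mnorm N m) powr - (1 + \<delta>) \<le> exp 2 * w (e m)"
      using n1 by (simp add: w_def powr_def flip: exp_add)
    also have "w (e m) = (\<Sum>j\<in>{e m}. w j * of_bool (real (mnorm N m) \<le> exp (real j)))"
      using le by simp
    also have "\<dots> \<le> (\<Sum>j\<le>J. w j * of_bool (real (mnorm N m) \<le> exp (real j)))"
      using eJ by (intro sum_mono2) (auto simp: w_def)
    finally show ?thesis by simp
  qed
  have "(\<Sum>m\<in>G. real (mnorm N m) powr - (1 + \<delta>)) \<le>
      (\<Sum>m\<in>G. exp 2 * (\<Sum>j\<le>J. w j * of_bool (real (mnorm N m) \<le> exp (real j))))"
    by (intro sum_mono pt)
  also have "\<dots> = exp 2 * (\<Sum>j\<le>J. w j * (\<Sum>m\<in>G. of_bool (real (mnorm N m) \<le> exp (real j))))"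
    by (subst sum_distrib_left[symmetric], subst sum.swap) (simp add: sum_distrib_left)
  also have "\<dots> \<le> exp 2 * (\<Sum>j\<le>J. C * exp (- \<delta>) ^ j)"
  proof (intro mult_left_mono sum_mono)
    fix j
    have "(\<Sum>m\<in>G. of_bool (real (mnorm N m) \<le> exp (real j))) = real (card {m \<in> G. real (mnorm N m) \<le> exp (real j)})"
      using G by (simp add: of_bool_def sum.If_cases Int_def)
    also have "\<dots> \<le> real (card (elts (exp (real j))))"
      using G by (intro of_nat_mono card_mono finite_elts) (auto simp: elts_def)
    also have "\<dots> \<le> C * exp (real j)" by (intro card_elts_le) simp
    finally have "w j * (\<Sum>m\<in>G. of_bool (real (mnorm N m) \<le> exp (real j))) \<le> w j * (C * exp (real j))"
      by (intro mult_left_mono) (auto simp: w_def)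
    also have "\<dots> = C * exp (- \<delta>) ^ j"
      by (simp add: w_def exp_of_nat_mult[symmetric] exp_add[symmetric] algebra_simps)
    finally show "w j * (\<Sum>m\<in>G. of_bool (real (mnorm N m) \<le> exp (real j))) \<le> C * exp (- \<delta>) ^ j" .
  qed auto
  also have "\<dots> = exp 2 * (C * (\<Sum>j\<le>J. exp (- \<delta>) ^ j))" by (simp add: sum_distrib_left)
  also have "\<dots> \<le> exp 2 * (C * (2 / \<delta>))"
  proof (intro mult_left_mono)
    have "(\<Sum>j\<le>J. exp (- \<delta>) ^ j) \<le> (\<Sum>j. exp (- \<delta>) ^ j)"
      using \<delta> by (intro sum_le_suminf summable_geometric) auto
    also have "\<dots> = 1 / (1 - exp (- \<delta>))" using \<delta> by (intro suminf_geometric) auto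
    also have "\<dots> \<le> 2 / \<delta>"
    proof -
      have "1 + \<delta> \<le> exp \<delta>" by (rule exp_ge_add_one_self)
      then have "exp (- \<delta>) \<le> 1 / (1 + \<delta>)" using \<delta> by (simp add: exp_minus field_simps)
      moreover have "1 / (1 + \<delta>) \<le> 1 - \<delta> / 2"
      proof -
        have "\<delta> * \<delta> \<le> \<delta> * 1" using \<delta> by (intro mult_left_mono) auto
        then show ?thesis using \<delta> by (simp add: field_simps)
      qed
      ultimately have "\<delta> / 2 \<le> 1 - exp (- \<delta>)" by simp
      then have "1 / (1 - exp (- \<delta>)) \<le> 1 / (\<delta> / 2)" using \<delta> by (intro divide_left_mono mult_pos_pos) auto
      then show ?thesis by simp
    qed
    finally show "(\<Sum>j\<le>J. exp (- \<delta>) ^ j) \<le> 2 / \<delta>" .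
  qed (use C_pos in auto)
  finally show ?thesis by (simp add: mult_ac)
qed

lemma sum_gens_le_zeta:
  assumes "0 < \<delta>" "\<delta> \<le> 1" "finite Q" "Q \<subseteq> P"
  shows "(\<Sum>p\<in>Q. real (N p) powr - (1 + \<delta>)) \<le> 2 * exp 2 * C / \<delta>"
proof -
  have "(\<Sum>p\<in>Q. real (N p) powr - (1 + \<delta>)) =
      (\<Sum>m\<in>(\<lambda>p. {#p#}) ` Q. real (mnorm N m) powr - (1 + \<delta>))"
    by (subst sum.reindex) (auto simp: inj_single)
  also have "\<dots> \<le> 2 * exp 2 * C / \<delta>" using assms by (intro zeta_partial_sum_le) auto
  finally show ?thesis .
qed

lemma sum_gens_square_le:
  assumes "finite Q" "Q \<subseteq> P"
  shows "(\<Sum>p\<in>Q. (1 / real (N p))\<^sup>2) \<le> 2 * exp 2 * C"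
proof -
  have "(1 / real (N p))\<^sup>2 = real (N p) powr - (1 + 1)" if "p \<in> Q" for p
    using that norm_gt_1[of p] assms by (auto simp: powr_minus power_divide divide_simps)
  then show ?thesis using sum_gens_le_zeta[of 1 Q] assms by simp
qed

text \<open>Take \<open>B\<close> so large that the linear bounds force at least \<open>C * y\<close> elements with norm in
  the interval from \<open>y\<close> to \<open>B * y\<close>.  Each such interval contributes a fixed positive
  amount to the sum of \<open>1 / N(m)\<close>, and there are about \<open>ln x / ln B\<close> disjoint intervals
  below \<open>x\<close>.\<close>

lemma harmonic_sum_ge:
  obtains b where "b > 0" "\<And>x. x \<ge> 1 \<Longrightarrow> b * ln x - 1 \<le> (\<Sum>m\<in>elts x. 1 / real (mnorm N m))"
proof -
  define B where "B = 2 * C / c"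
  have B: "B \<ge> 2" using c_pos c_le_C by (simp add: B_def field_simps)
  define H where "H x = (\<Sum>m\<in>elts x. 1 / real (mnorm N m))" for x
  \<comment> \<open>The interval contributes \<open>C / B\<close>; the cap at \<open>1\<close> makes the loss from the last, incomplete interval at most \<open>1\<close>.\<close>
  define d where "d = min 1 (C / B)"
  have d: "0 < d" "d \<le> 1" "d \<le> C / B" using B C_pos by (auto simp: d_def)
  have step: "H (B * y) \<ge> H y + d" if y: "y \<ge> 1" for y
  proof -
    have By: "y \<le> B * y" using B y by simp
    have cB: "c * (B * y) = 2 * C * y" using c_pos by (simp add: B_def)
    have "B * y \<ge> 1" using By y by linarith
    from card_elts_ge[OF this] have "2 * C * y \<le> real (card (elts (B * y)))" using cB by simp
    moreover have "real (card (elts y)) \<le> C * y" using y by (intro card_elts_le) auto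
    moreover have "card (elts (B * y) - elts y) = card (elts (B * y)) - card (elts y)"
      by (intro card_Diff_subset finite_elts elts_mono By)
    ultimately have cd: "real (card (elts (B * y) - elts y)) \<ge> C * y"
      using card_mono[OF finite_elts elts_mono[OF By]] by (simp add: of_nat_diff)
    have "d \<le> C * y * (1 / (B * y))" using d y by simp
    also have "\<dots> \<le> real (card (elts (B * y) - elts y)) * (1 / (B * y))"
      using cd B y by (intro mult_right_mono) auto
    also have "\<dots> = (\<Sum>m\<in>elts (B * y) - elts y. 1 / (B * y))" by simp
    also have "\<dots> \<le> (\<Sum>m\<in>elts (B * y) - elts y. 1 / real (mnorm N m))"
      using mnorm_pos B y by (intro sum_mono divide_left_mono mult_pos_pos) (auto simp: elts_def)
    also have "\<dots> = H (B * y) - H y"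
      unfolding H_def by (intro sum_diff finite_elts elts_mono By)
    finally show ?thesis by simp
  qed
  have pow: "H (B ^ k) \<ge> real k * d" for k
  proof (induction k)
    case 0 then show ?case by (auto simp: H_def intro!: sum_nonneg)
  next
    case (Suc k)
    have "B ^ k \<ge> 1" using B by simp
    from step[OF this] Suc show ?case by (simp add: algebra_simps)
  qed
  show ?thesis
  proof (rule that[of "d / ln B"])
    show "0 < d / ln B" using d B by simp
    fix x :: real assume x: "x \<ge> 1"
    define k where "k = nat \<lfloor>ln x / ln B\<rfloor>"
    have lB: "ln B > 0" using B by simp
    have "ln x / ln B \<ge> 0" using x lB by simp
    then have k: "real k \<le> ln x / ln B" "ln x / ln B \<le> real k + 1" unfolding k_def by linarith+
    have "ln (B ^ k) \<le> ln x" using k(1) lB B by (simp add: ln_realpow field_simps)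
    then have Bk: "B ^ k \<le> x" using B x by (subst (asm) ln_le_cancel_iff) auto
    have "d * (ln x / ln B) \<le> d * (real k + 1)" using d k by (intro mult_left_mono) auto
    then have "d / ln B * ln x - 1 \<le> real k * d" using d by (simp add: algebra_simps)
    also have "\<dots> \<le> H (B ^ k)" by (rule pow)
    also have "\<dots> \<le> H x" unfolding H_def by (intro sum_mono2 finite_elts elts_mono Bk) auto
    finally show "d / ln B * ln x - 1 \<le> (\<Sum>m\<in>elts x. 1 / real (mnorm N m))" by (simp add: H_def)
  qed
qed

section \<open>The reciprocal sum over the generators\<close>

lemma set_mset_subset_gens: "m \<in> elts x \<Longrightarrow> set_mset m \<subseteq> gens x"
proof
  fix p assume m: "m \<in> elts x" and p: "p \<in># m"
  then obtain m' where "m = add_mset p m'" by (metis multi_member_split)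
  with m have P: "p \<in> P" "m' \<in> free_monoid P" "real (N p) * real (mnorm N m') \<le> x"
    by (auto simp: elts_def mnorm_add_mset)
  moreover have "real (N p) * 1 \<le> real (N p) * real (mnorm N m')"
    using mnorm_ge_1[OF P(2)] by (intro mult_left_mono) auto
  ultimately show "p \<in> gens x" by (auto simp: gens_def)
qed

text \<open>Elements of norm at most \<open>x\<close> are supported on generators of norm at most \<open>x\<close>, so the
  Euler product dominates the harmonic sum.  The logarithm of the product is the
  reciprocal sum up to \<open>\<Sum>p. 1 / N(p)\<^sup>2\<close>, which is bounded.  Together with
  \<open>harmonic_sum_ge\<close> this bounds \<open>recip_sum\<close> from below by \<open>ln (ln x)\<close> minus a constant.\<close>

lemma ln_harmonic_sum_le_recip_sum:
  assumes "x \<ge> 1"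
  shows "ln (\<Sum>m\<in>elts x. 1 / real (mnorm N m)) \<le> recip_sum x + 4 * exp 2 * C"
proof -
  define H where "H = (\<Sum>m\<in>elts x. 1 / real (mnorm N m))"
  have u: "0 < 1 / real (N p)" "1 / real (N p) \<le> 1 / 2" if "p \<in> gens x" for p
    using norm_gt_1[of p] that by (auto simp: gens_def field_simps)
  have "H > 0" unfolding H_def using empty_in_elts[OF assms] mnorm_pos
    by (intro sum_pos finite_elts) (blast, auto simp: elts_def)
  moreover have "H \<le> (\<Prod>p\<in>gens x. 1 / (1 - 1 / real (N p)))"
    unfolding H_def using finite_gens finite_elts set_mset_subset_gens
    by (intro sum_inverse_mnorm_le_euler_product) (auto simp: gens_def)
  ultimately have "ln H \<le> ln (\<Prod>p\<in>gens x. 1 / (1 - 1 / real (N p)))" by simp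
  also have "\<dots> = (\<Sum>p\<in>gens x. - ln (1 - 1 / real (N p)))"
    using u finite_gens by (subst ln_prod) (force simp: ln_div intro!: sum.cong)+
  also have "\<dots> \<le> (\<Sum>p\<in>gens x. 1 / real (N p) + 2 * (1 / real (N p))\<^sup>2)"
    using u by (intro sum_mono) (smt (verit) ln_one_minus_pos_lower_bound)
  also have "\<dots> = recip_sum x + 2 * (\<Sum>p\<in>gens x. (1 / real (N p))\<^sup>2)"
    by (simp add: sum.distrib recip_sum_def sum_distrib_left)
  also have "\<dots> \<le> recip_sum x + 2 * (2 * exp 2 * C)"
    using sum_gens_square_le[OF finite_gens, of x] by (simp add: gens_def subset_iff mult_ac)
  finally show ?thesis by (simp add: H_def)
qed

text \<open>Multiplying out \<open>\<Prod>p\<in>Q. 1 + N(p) powr - (1 + \<delta>)\<close> gives the part of the zeta function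
  at \<open>1 + \<delta>\<close> that belongs to the squarefree elements supported on \<open>Q\<close>.  This is a finite
  sum, so the bound for the pole applies; then take logarithms.\<close>

lemma sum_gens_powr_le_ln:
  assumes \<delta>: "0 < \<delta>" "\<delta> \<le> 1" and Q: "finite Q" "Q \<subseteq> P"
  shows "(\<Sum>p\<in>Q. real (N p) powr - (1 + \<delta>)) \<le> ln (2 * exp 2 * C / \<delta>) + 2 * exp 2 * C"
proof -
  define u where "u p = real (N p) powr - (1 + \<delta>)" for p
  have N1: "real (N p) > 1" if "p \<in> Q" for p using that norm_gt_1[of p] Q by auto
  have u0: "0 < u p" if "p \<in> Q" for p using N1[OF that] by (simp add: u_def)
  have u1: "u p \<le> 1 / real (N p)" if "p \<in> Q" for p
  proof -
    have "u p \<le> real (N p) powr - 1" unfolding u_def using N1[OF that] \<delta> by (intro powr_mono) auto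
    then show ?thesis using N1[OF that] by (simp add: powr_minus_divide)
  qed
  have u1': "u p \<le> 1" if "p \<in> Q" for p
    using u1[OF that] N1[OF that] by (smt (verit) divide_le_eq_1)
  have "(\<Prod>p\<in>Q. u p + 1) = (\<Sum>T\<in>Pow Q. (\<Prod>p\<in>T. u p) * (\<Prod>p\<in>Q - T. 1))"
    using Q by (intro prod_add)
  also have "\<dots> = (\<Sum>T\<in>Pow Q. real (mnorm N (mset_set T)) powr - (1 + \<delta>))"
    unfolding u_def mnorm_mset_set
    by (simp add: prod_powr_distrib)
  also have "\<dots> = (\<Sum>m\<in>mset_set ` Pow Q. real (mnorm N m) powr - (1 + \<delta>))"
    using Q(1) by (subst sum.reindex) (auto simp: inj_on_def finite_subset[OF _ Q(1)])
  also have "\<dots> \<le> 2 * exp 2 * C / \<delta>"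
    using Q \<delta> by (intro zeta_partial_sum_le)
      (auto intro!: mset_set_in_free_monoid intro: finite_subset)
  finally have *: "(\<Prod>p\<in>Q. u p + 1) \<le> 2 * exp 2 * C / \<delta>" .
  have "(\<Sum>p\<in>Q. u p - (1 / real (N p))\<^sup>2) \<le> (\<Sum>p\<in>Q. ln (u p + 1))"
  proof (rule sum_mono)
    fix p assume p: "p \<in> Q"
    have "(u p)\<^sup>2 \<le> (1 / real (N p))\<^sup>2" using u0[OF p] u1[OF p] by (intro power_mono) auto
    moreover have "u p - (u p)\<^sup>2 \<le> ln (1 + u p)"
      using u0[OF p] u1'[OF p] by (intro ln_one_plus_pos_lower_bound) auto
    ultimately show "u p - (1 / real (N p))\<^sup>2 \<le> ln (u p + 1)" by (simp add: add.commute)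
  qed
  also have "\<dots> = ln (\<Prod>p\<in>Q. u p + 1)"
    using Q u0 by (subst ln_prod) (force intro: add_pos_pos)+
  also have "\<dots> \<le> ln (2 * exp 2 * C / \<delta>)"
  proof (subst ln_le_cancel_iff)
    show "0 < (\<Prod>p\<in>Q. u p + 1)" using u0 by (intro prod_pos) (auto intro: add_pos_pos)
  qed (use * C_pos \<delta> in auto)
  finally have "(\<Sum>p\<in>Q. u p) \<le> ln (2 * exp 2 * C / \<delta>) + (\<Sum>p\<in>Q. (1 / real (N p))\<^sup>2)"
    by (simp add: sum_subtractf)
  with sum_gens_square_le[OF Q] show ?thesis by (simp add: u_def)
qed

text \<open>Since \<open>N(p) powr \<delta> \<le> exp \<eta>\<close> for \<open>N(p) \<le> x\<close> when \<open>\<delta> = \<eta> / ln x\<close>, passing from the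
  exponent \<open>1\<close> to \<open>1 + \<delta>\<close> costs only the factor \<open>exp \<eta>\<close>, which is as close to \<open>1\<close> as
  desired, while the dependence of the pole on \<open>\<eta>\<close> is pushed into the additive constant.\<close>

lemma recip_sum_le:
  assumes \<eta>: "0 < \<eta>" "\<eta> \<le> 1" and x: "x \<ge> exp 1"
  shows "recip_sum x \<le> exp \<eta> * (ln (ln x) + (ln (2 * exp 2 * C / \<eta>) + 2 * exp 2 * C))"
proof -
  have x0: "x > 0" using x by (smt (verit) exp_gt_zero)
  have l1: "ln x \<ge> 1" using x x0 by (metis exp_le_cancel_iff exp_ln)
  define \<delta> where "\<delta> = \<eta> / ln x"
  have \<delta>: "0 < \<delta>" "\<delta> \<le> 1" using \<eta> l1 by (auto simp: \<delta>_def field_simps)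
  have "recip_sum x \<le> (\<Sum>p\<in>gens x. exp \<eta> * real (N p) powr - (1 + \<delta>))"
    unfolding recip_sum_def
  proof (rule sum_mono)
    fix p assume p: "p \<in> gens x"
    have N1: "real (N p) > 1" "real (N p) \<le> x" using p norm_gt_1[of p] by (auto simp: gens_def)
    have "ln (real (N p)) \<le> ln x" using N1 x0 by simp
    then have "\<delta> * ln (real (N p)) \<le> \<delta> * ln x" using \<delta> by (intro mult_left_mono) auto
    also have "\<delta> * ln x = \<eta>" using l1 by (simp add: \<delta>_def)
    finally have "exp (- ln (real (N p))) \<le> exp (\<eta> + - (1 + \<delta>) * ln (real (N p)))"
      by (simp add: algebra_simps)
    then show "1 / real (N p) \<le> exp \<eta> * real (N p) powr - (1 + \<delta>)"
      using N1 by (simp only: exp_add powr_def) (auto simp: exp_minus inverse_eq_divide)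
  qed
  also have "\<dots> = exp \<eta> * (\<Sum>p\<in>gens x. real (N p) powr - (1 + \<delta>))"
    by (simp add: sum_distrib_left)
  also have "\<dots> \<le> exp \<eta> * (ln (2 * exp 2 * C / \<delta>) + 2 * exp 2 * C)"
    using \<delta> finite_gens by (intro mult_left_mono sum_gens_powr_le_ln) (auto simp: gens_def)
  also have "ln (2 * exp 2 * C / \<delta>) = ln (ln x) + ln (2 * exp 2 * C / \<eta>)"
    using \<eta> l1 C_pos by (simp add: \<delta>_def ln_mult_pos ln_div)
  finally show ?thesis by (simp add: add.assoc)
qed

text \<open>A weak form of Mertens' theorem: \<open>recip_sum x\<close> is asymptotic to \<open>ln (ln x)\<close>.\<close>

lemma eventually_recip_sum_between:
  assumes \<rho>: "\<rho> > 0"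
  shows "eventually (\<lambda>x. (1 - \<rho>) * ln (ln x) \<le> recip_sum x \<and> recip_sum x \<le> (1 + \<rho>) * ln (ln x)) at_top"
proof -
  have L: "filterlim (\<lambda>x::real. ln (ln x)) at_top at_top"
    by (rule filterlim_compose[OF ln_at_top ln_at_top])
  obtain b where b: "b > 0" "\<And>x. x \<ge> 1 \<Longrightarrow> b * ln x - 1 \<le> (\<Sum>m\<in>elts x. 1 / real (mnorm N m))"
    using harmonic_sum_ge by blast
  define E where "E = 4 * exp 2 * C - ln (b / 2)"
  define \<eta> where "\<eta> = min 1 (ln (1 + \<rho> / 2))"
  have \<eta>: "0 < \<eta>" "\<eta> \<le> 1" using \<rho> by (auto simp: \<eta>_def)
  have "exp \<eta> \<le> exp (ln (1 + \<rho> / 2))" by (simp add: \<eta>_def)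
  then have e\<eta>: "exp \<eta> \<le> 1 + \<rho> / 2" using \<rho> by simp
  define D where "D = ln (2 * exp 2 * C / \<eta>) + 2 * exp 2 * C"
  have "eventually (\<lambda>x. ln x \<ge> 2 / b) at_top" using ln_at_top by (simp add: filterlim_at_top)
  moreover have "eventually (\<lambda>x. ln (ln x) \<ge> E / \<rho>) at_top" "eventually (\<lambda>x. ln (ln x) \<ge> - D) at_top"
    "eventually (\<lambda>x. ln (ln x) \<ge> (1 + \<rho> / 2) * D / (\<rho> / 2)) at_top"
    using L by (simp_all add: filterlim_at_top)
  moreover have "eventually (\<lambda>x::real. x \<ge> exp 1) at_top" by (rule eventually_ge_at_top)
  ultimately show ?thesis
  proof eventually_elim
    case (elim x)
    have x1: "x \<ge> 1" using elim(5) exp_ge_add_one_self[of 1] by linarith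
    have lx: "ln x > 0" using elim(1) b(1) by (smt (verit) divide_pos_pos)
    have "b / 2 * ln x \<le> b * ln x - 1" using elim(1) b(1) by (simp add: field_simps)
    also have "\<dots> \<le> (\<Sum>m\<in>elts x. 1 / real (mnorm N m))" by (rule b(2)[OF x1])
    finally have "ln (b / 2 * ln x) \<le> ln (\<Sum>m\<in>elts x. 1 / real (mnorm N m))"
      using b(1) lx by (subst ln_le_cancel_iff) (auto intro: less_le_trans[of _ "b / 2 * ln x"])
    also have "\<dots> \<le> recip_sum x + 4 * exp 2 * C" by (rule ln_harmonic_sum_le_recip_sum[OF x1])
    also have "ln (b / 2 * ln x) = ln (b / 2) + ln (ln x)" using b(1) lx by (intro ln_mult_pos) auto
    finally have "ln (ln x) - E \<le> recip_sum x" by (simp add: E_def)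
    moreover have "E \<le> \<rho> * ln (ln x)" using elim(2) \<rho> by (simp add: field_simps)
    moreover have "recip_sum x \<le> exp \<eta> * (ln (ln x) + D)"
      unfolding D_def by (rule recip_sum_le[OF \<eta> elim(5)])
    moreover have "exp \<eta> * (ln (ln x) + D) \<le> (1 + \<rho> / 2) * (ln (ln x) + D)"
      using e\<eta> elim(3) by (intro mult_right_mono) auto
    moreover have "(1 + \<rho> / 2) * D \<le> \<rho> / 2 * ln (ln x)" using elim(4) \<rho> by (simp add: field_simps)
    moreover have "(1 + \<rho> / 2) * (ln (ln x) + D) =
        (1 + \<rho>) * ln (ln x) - \<rho> / 2 * ln (ln x) + (1 + \<rho> / 2) * D"
      by (simp add: field_simps)
    moreover have "(1 - \<rho>) * ln (ln x) = ln (ln x) - \<rho> * ln (ln x)" by (simp add: algebra_simps)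
    ultimately show ?case by linarith
  qed
qed

lemma filterlim_recip_sum: "filterlim recip_sum at_top at_top"
proof -
  have "filterlim (\<lambda>x::real. 1 / 2 * ln (ln x)) at_top at_top"
    by (intro filterlim_tendsto_pos_mult_at_top[OF tendsto_const] filterlim_compose[OF ln_at_top ln_at_top]) auto
  then show ?thesis
    by (rule filterlim_at_top_mono)
      (use eventually_recip_sum_between[of "1 / 2"] in \<open>auto elim: eventually_mono\<close>)
qed

end

section \<open>A positive proportion of \<open>h\<close>-free elements\<close>

text \<open>Division of every multiplicity by \<open>2\<close> with remainder: \<open>n\<close> collects the generators of odd
  multiplicity.\<close>

lemma double_part_decomposition:
  obtains n k :: "'a multiset" where "m = n + (k + k)" "h_free 2 n"
proof (induction m arbitrary: thesis)
  case empty
  show ?case by (rule empty[of "{#}" "{#}"]) (auto simp: h_free_def)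
next
  case (add p m)
  obtain n k where nk: "m = n + (k + k)" "h_free 2 n" by (rule add.IH)
  show ?case
  proof (cases "p \<in># n")
    case True
    then obtain n' where n': "n = add_mset p n'" by (metis multi_member_split)
    have "count n' r \<le> count n r" for r by (simp add: n')
    then have "h_free 2 n'" using nk(2) unfolding h_free_def by (meson le_trans)
    then show ?thesis using add.prems[of n' "add_mset p k"] nk n' by simp
  next
    case False
    then have "h_free 2 (add_mset p n)"
      using nk(2) by (auto simp: h_free_def count_eq_zero_iff)
    then show ?thesis using add.prems[of "add_mset p n" k] nk by simp
  qed
qed

lemma h_free_mono: "h_free h m \<Longrightarrow> h \<le> h' \<Longrightarrow> h_free h' m"
  unfolding h_free_def by (meson diff_le_mono le_trans)

context linear_growth
begin

text \<open>Squarefree elements are \<open>h\<close>-free, so it suffices to treat \<open>h = 2\<close>.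
  Writing \<open>m = n + 2 k\<close> with \<open>n\<close> squarefree bounds the number of all elements up to \<open>x\<close> by the sum over \<open>k\<close> of the number of squarefree
  elements up to \<open>x / N(k)\<^sup>2\<close>.  The finitely many \<open>k\<close> with \<open>N(k) \<le> K\<close> contribute at most
  a constant times the number of squarefree elements up to \<open>x\<close>.  The remaining \<open>k\<close>
  contribute at most \<open>C * x\<close> times the tail of \<open>\<Sum>k. 1 / N(k)\<^sup>2\<close>, which for large \<open>K\<close> is
  at most half of the lower bound \<open>c * x\<close> for the left-hand side.\<close>

lemma card_h_free_upto_ge:
  assumes "h \<ge> 2"
  obtains d where "d > 0" "\<And>x. x \<ge> 1 \<Longrightarrow> d * x \<le> real (card (h_free_upto P N h x))"
proof -
  define S where "S x = h_free_upto P N 2 x" for x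
  have S_sub: "S x \<subseteq> elts x" for x by (auto simp: S_def h_free_upto_def elts_def)
  have S_fin: "finite (S x)" for x using S_sub finite_elts finite_subset by blast
  have S_mono: "S x \<subseteq> S y" if "x \<le> y" for x y using that by (auto simp: S_def h_free_upto_def)
  \<comment> \<open>Splitting \<open>1 / N(k)\<^sup>2\<close> as \<open>N(k) powr - (1 / 2)\<close> times \<open>N(k) powr - (3 / 2)\<close>, the tail is at most \<open>4 * exp 2 * C / sqrt K\<close>; this \<open>K\<close> makes \<open>C\<close> times it at most \<open>c / 2\<close>.\<close>
  define K where "K = (8 * exp 2 * C\<^sup>2 / c)\<^sup>2 + 1"
  have K: "K \<ge> 1" by (simp add: K_def)
  define a where "a = real (card (elts K))"
  have a: "a > 0" using empty_in_elts[OF K] finite_elts by (auto simp: a_def card_gt_0_iff)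
  have main: "c / (2 * a) * x \<le> real (card (S x))" if x: "x \<ge> 1" for x
  proof -
    let ?y = "\<lambda>k. x / (real (mnorm N k))\<^sup>2"
    have cover: "elts x \<subseteq> (\<Union>k\<in>elts x. (\<lambda>n. n + (k + k)) ` S (?y k))"
    proof
      fix m assume m: "m \<in> elts x"
      obtain n k where nk: "m = n + (k + k)" "h_free 2 n" by (rule double_part_decomposition)
      have M: "n \<in> free_monoid P" "k \<in> free_monoid P" using m nk by (auto simp: elts_def)
      have pos: "real (mnorm N k) > 0" using mnorm_pos[OF M(2)] by simp
      have le: "real (mnorm N n) * (real (mnorm N k))\<^sup>2 \<le> x"
        using m nk by (simp add: elts_def mnorm_add power2_eq_square)
      have "1 * real (mnorm N k) \<le> (real (mnorm N n) * real (mnorm N k)) * real (mnorm N k)"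
        using mnorm_ge_1[OF M(1)] mnorm_ge_1[OF M(2)] pos
        by (intro mult_right_mono) (auto simp flip: of_nat_mult)
      then have "k \<in> elts x" using le M by (simp add: elts_def power2_eq_square mult.assoc)
      moreover have "n \<in> S (?y k)"
        using le pos nk M by (simp add: S_def h_free_upto_def field_simps)
      ultimately show "m \<in> (\<Union>k\<in>elts x. (\<lambda>n. n + (k + k)) ` S (?y k))" using nk by blast
    qed
    have "c * x \<le> real (card (elts x))" by (rule card_elts_ge[OF x])
    also have "\<dots> \<le> real (card (\<Union>k\<in>elts x. (\<lambda>n. n + (k + k)) ` S (?y k)))"
      using cover finite_elts S_fin by (intro of_nat_mono card_mono) auto
    also have "\<dots> \<le> real (\<Sum>k\<in>elts x. card ((\<lambda>n. n + (k + k)) ` S (?y k)))"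
      by (intro of_nat_mono card_UN_le finite_elts)
    also have "\<dots> = (\<Sum>k\<in>elts x. real (card (S (?y k))))"
      by (simp add: card_image inj_on_def)
    also have "\<dots> \<le> (\<Sum>k\<in>elts x. of_bool (k \<in> elts K) * real (card (S x)) +
        C * x / sqrt K * real (mnorm N k) powr - (1 + 1 / 2))"
    proof (rule sum_mono)
      fix k assume k: "k \<in> elts x"
      then have kM: "k \<in> free_monoid P" by (simp add: elts_def)
      have n1: "real (mnorm N k) \<ge> 1" using mnorm_ge_1[OF kM] by simp
      show "real (card (S (?y k))) \<le> of_bool (k \<in> elts K) * real (card (S x)) +
        C * x / sqrt K * real (mnorm N k) powr - (1 + 1 / 2)"
      proof (cases "k \<in> elts K")
        case True
        have "?y k \<le> x" using n1 x by (simp add: field_simps mult_le_cancel_left1)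
        then have "card (S (?y k)) \<le> card (S x)" by (intro card_mono S_fin S_mono)
        moreover have "0 \<le> C * x / sqrt K * real (mnorm N k) powr - (1 + 1 / 2)"
          using C_pos x K by (intro mult_nonneg_nonneg divide_nonneg_nonneg) auto
        ultimately show ?thesis using True by simp
      next
        case False
        then have nK: "real (mnorm N k) > K" using kM by (auto simp: elts_def)
        have "real (card (S (?y k))) \<le> real (card (elts (?y k)))"
          by (intro of_nat_mono card_mono S_sub finite_elts)
        also have "\<dots> \<le> C * ?y k" using x by (intro card_elts_le) auto
        also have "\<dots> \<le> C * x * (1 / sqrt K * real (mnorm N k) powr - (1 + 1 / 2))"
        proof -
          have "1 / (real (mnorm N k))\<^sup>2 = real (mnorm N k) powr - (1 / 2) * real (mnorm N k) powr - (1 + 1 / 2)"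
            using n1 by (simp add: powr_minus_divide flip: powr_add)
          also have "\<dots> \<le> 1 / sqrt K * real (mnorm N k) powr - (1 + 1 / 2)"
            using n1 nK K by (intro mult_right_mono) (auto simp: powr_minus powr_half_sqrt field_simps)
          finally have "C * x * (1 / (real (mnorm N k))\<^sup>2) \<le> C * x * (1 / sqrt K * real (mnorm N k) powr - (1 + 1 / 2))"
            using C_pos x by (intro mult_left_mono) auto
          then show ?thesis by simp
        qed
        finally show ?thesis using False by simp
      qed
    qed
    also have "\<dots> = real (card (elts x \<inter> elts K)) * real (card (S x)) +
        C * x / sqrt K * (\<Sum>k\<in>elts x. real (mnorm N k) powr - (1 + 1 / 2))"
      using finite_elts by (simp add: sum.distrib sum_distrib_left sum_of_bool_mult_eq)
    also have "\<dots> \<le> a * real (card (S x)) + C * x / sqrt K * (2 * exp 2 * C / (1 / 2))"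
      using x K C_pos finite_elts unfolding a_def
      by (intro add_mono mult_right_mono mult_left_mono zeta_partial_sum_le of_nat_mono card_mono)
        (auto simp: elts_def)
    also have "C * x / sqrt K * (2 * exp 2 * C / (1 / 2)) = x * (4 * exp 2 * C\<^sup>2 / sqrt K)"
      by (simp add: power2_eq_square)
    also have "\<dots> \<le> x * (c / 2)"
    proof (intro mult_left_mono)
      have "8 * exp 2 * C\<^sup>2 / c \<le> sqrt K"
        by (rule real_le_rsqrt) (simp add: K_def)
      then show "4 * exp 2 * C\<^sup>2 / sqrt K \<le> c / 2" using c_pos K by (simp add: field_simps)
    qed (use x in auto)
    finally show ?thesis using a by (simp add: field_simps)
  qed
  show ?thesis
  proof (rule that[of "c / (2 * a)"])
    show "0 < c / (2 * a)" using c_pos a by simp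
    fix x :: real assume x: "x \<ge> 1"
    have sub: "S x \<subseteq> h_free_upto P N h x"
      using h_free_mono[OF _ assms] by (auto simp: S_def h_free_upto_def)
    have "finite (h_free_upto P N h x)"
      by (rule finite_subset[OF _ finite_elts[of x]]) (auto simp: h_free_upto_def elts_def)
    then have "card (S x) \<le> card (h_free_upto P N h x)" using sub by (rule card_mono)
    with main[OF x] show "c / (2 * a) * x \<le> real (card (h_free_upto P N h x))" by linarith
  qed
qed

section \<open>The first two moments of \<open>omega\<close>\<close>

lemma omega_eq_sum:
  assumes "m \<in> elts x"
  shows "real (omega m) = (\<Sum>p\<in>gens x. of_bool (p \<in># m))"
proof -
  have "set_mset m = {p \<in> gens x. p \<in># m}" using set_mset_subset_gens[OF assms] by auto
  then show ?thesis
    unfolding omega_eq_card_set_mset using finite_gens by (simp add: of_bool_def sum.If_cases Int_def)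
qed

lemma sum_of_bool_multiple:
  assumes "k \<in> free_monoid P"
  shows "(\<Sum>m\<in>elts x. of_bool (k \<subseteq># m)) = real (card (elts (x / real (mnorm N k))))"
  using finite_elts
  by (simp add: of_bool_def sum.If_cases Int_def card_multiples[OF assms, symmetric])

lemma sum_omega:
  "(\<Sum>m\<in>elts x. real (omega m)) = (\<Sum>p\<in>gens x. real (card (elts (x / real (N p)))))"
proof -
  have "(\<Sum>m\<in>elts x. real (omega m)) = (\<Sum>p\<in>gens x. \<Sum>m\<in>elts x. of_bool (p \<in># m))"
    by (subst sum.swap) (simp add: omega_eq_sum)
  also have "\<dots> = (\<Sum>p\<in>gens x. real (card (elts (x / real (N p)))))"
  proof (rule sum.cong)
    fix p assume "p \<in> gens x"
    then show "(\<Sum>m\<in>elts x. of_bool (p \<in># m)) = real (card (elts (x / real (N p))))"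
      using sum_of_bool_multiple[of "{#p#}" x] by (simp add: gens_def)
  qed simp
  finally show ?thesis .
qed

text \<open>The square of \<open>omega m\<close> counts ordered pairs of generators dividing \<open>m\<close>.  Pairs of
  equal generators account for \<open>omega m\<close>; a pair of distinct generators divides \<open>m\<close> exactly
  if their sum does.  The double sum on the right-hand side also runs over \<open>p = r\<close>,
  which only increases it and lets it be compared with \<open>(recip_sum x)\<^sup>2\<close>.\<close>

lemma sum_omega_square_le:
  "(\<Sum>m\<in>elts x. (real (omega m))\<^sup>2) \<le> (\<Sum>m\<in>elts x. real (omega m)) +
     (\<Sum>p\<in>gens x. \<Sum>r\<in>gens x. real (card (elts (x / real (N p) / real (N r)))))"
proof -
  have "(real (omega m))\<^sup>2 \<le> real (omega m) + (\<Sum>p\<in>gens x. \<Sum>r\<in>gens x. of_bool ({#p, r#} \<subseteq># m))"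
    if m: "m \<in> elts x" for m
  proof -
    have "(real (omega m))\<^sup>2 = (\<Sum>p\<in>gens x. \<Sum>r\<in>gens x. of_bool (p \<in># m) * of_bool (r \<in># m))"
      by (simp add: omega_eq_sum[OF m] power2_eq_square sum_product)
    also have "\<dots> \<le> (\<Sum>p\<in>gens x. \<Sum>r\<in>gens x. of_bool (p = r) * of_bool (p \<in># m) + of_bool ({#p, r#} \<subseteq># m))"
      by (intro sum_mono) (auto simp: of_bool_def insert_subset_eq_iff in_diff_count)
    also have "\<dots> = real (omega m) + (\<Sum>p\<in>gens x. \<Sum>r\<in>gens x. of_bool ({#p, r#} \<subseteq># m))"
    proof -
      have "(\<Sum>r\<in>gens x. of_bool (p = r) * of_bool (p \<in># m)) = (of_bool (p \<in># m) :: real)"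
        if "p \<in> gens x" for p
      proof -
        have "(\<Sum>r\<in>gens x. of_bool (p = r) * of_bool (p \<in># m)) =
            (\<Sum>r\<in>gens x. if r = p then of_bool (p \<in># m) else (0 :: real))"
          by (intro sum.cong) auto
        then show ?thesis using finite_gens that by simp
      qed
      then show ?thesis by (simp add: sum.distrib omega_eq_sum[OF m])
    qed
    finally show ?thesis .
  qed
  then have "(\<Sum>m\<in>elts x. (real (omega m))\<^sup>2) \<le>
      (\<Sum>m\<in>elts x. real (omega m) + (\<Sum>p\<in>gens x. \<Sum>r\<in>gens x. of_bool ({#p, r#} \<subseteq># m)))"
    by (rule sum_mono)
  also have "\<dots> = (\<Sum>m\<in>elts x. real (omega m)) +
      (\<Sum>p\<in>gens x. \<Sum>r\<in>gens x. \<Sum>m\<in>elts x. of_bool ({#p, r#} \<subseteq># m))"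
    by (simp add: sum.distrib sum.swap[of _ "gens x" "elts x"])
  also have "(\<Sum>p\<in>gens x. \<Sum>r\<in>gens x. \<Sum>m\<in>elts x. of_bool ({#p, r#} \<subseteq># m)) =
      (\<Sum>p\<in>gens x. \<Sum>r\<in>gens x. real (card (elts (x / real (N p) / real (N r)))))"
  proof (intro sum.cong refl)
    fix p r assume "p \<in> gens x" "r \<in> gens x"
    then show "(\<Sum>m\<in>elts x. of_bool ({#p, r#} \<subseteq># m)) = real (card (elts (x / real (N p) / real (N r))))"
      using sum_of_bool_multiple[of "{#p, r#}" x] by (simp add: gens_def mnorm_add_mset)
  qed
  finally show ?thesis .
qed

end

text \<open>The asymptotic formula for the counting function, along \<open>X\<close>.  The form with an additive
  constant \<open>K\<close> holds for all positive members of \<open>X\<close> and not only for large ones, so it can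
  be applied at \<open>x / N(p)\<close> for every generator of norm up to \<open>x\<close> and then summed.\<close>

locale asymptotic_growth = linear_growth +
  fixes X :: "real set" and \<kappa> :: real
  assumes \<kappa>_pos: "\<kappa> > 0"
    and divide_norm_in_X: "x \<in> X \<Longrightarrow> m \<in> free_monoid P \<Longrightarrow> x / real (mnorm N m) \<in> X"
    and card_elts_approx: "\<eta> > 0 \<Longrightarrow>
      \<exists>K. \<forall>x\<in>X. x > 0 \<longrightarrow> \<bar>real (card (elts x)) - \<kappa> * x\<bar> \<le> \<eta> * x + K"
begin

text \<open>Turan's inequality.  With \<open>S = recip_sum x\<close>, the three terms of
  \<open>\<Sum>m. (omega m)\<^sup>2 - 2 * S * omega m + S\<^sup>2\<close> have leading parts \<open>\<kappa> x S\<^sup>2\<close>, \<open>- 2 \<kappa> x S\<^sup>2\<close> and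
  \<open>\<kappa> x S\<^sup>2\<close>, which cancel.  The relative errors \<open>\<eta>\<close> add up to \<open>4 \<eta> x S\<^sup>2\<close>; the
  diagonal pairs of generators and the additive constant \<open>K\<close> contribute terms of order \<open>x S\<close> and \<open>S\<^sup>2\<close>, thus negligible
  because \<open>S\<close> and \<open>x\<close> tend to infinity.\<close>

lemma eventually_variance_le:
  assumes \<delta>: "\<delta> > 0"
  shows "eventually (\<lambda>x. (\<Sum>m\<in>elts x. (real (omega m) - recip_sum x)\<^sup>2) \<le> \<delta> * x * (recip_sum x)\<^sup>2)
    (at_top_in X)"
proof -
  define \<eta> where "\<eta> = \<delta> / 6"
  have \<eta>: "\<eta> > 0" using \<delta> by (simp add: \<eta>_def)
  obtain K0 where K0: "\<forall>x\<in>X. x > 0 \<longrightarrow> \<bar>real (card (elts x)) - \<kappa> * x\<bar> \<le> \<eta> * x + K0"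
    using card_elts_approx[OF \<eta>] by blast
  define K where "K = max K0 0"
  have K_nonneg: "K \<ge> 0" by (simp add: K_def)
  have K: "\<bar>real (card (elts x)) - \<kappa> * x\<bar> \<le> \<eta> * x + K" if "x \<in> X" "x > 0" for x
    using K0 that by (force simp: K_def)
  have bound: "(\<Sum>m\<in>elts x. (real (omega m) - recip_sum x)\<^sup>2) \<le> \<delta> * x * (recip_sum x)\<^sup>2"
    if xX: "x \<in> X" and x: "x \<ge> 1" "x \<ge> K / \<eta>" and S_big: "recip_sum x \<ge> (1 + 3 * K) * C / \<eta>" for x
  proof -
    define S where "S = recip_sum x"
    define T1 where "T1 = (\<Sum>m\<in>elts x. real (omega m))"
    define T2 where "T2 = (\<Sum>m\<in>elts x. (real (omega m))\<^sup>2)"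
    define A where "A = real (card (elts x))"
    have S0: "S \<ge> 0" unfolding S_def by (rule recip_sum_nonneg)
    have Np: "real (N p) > 1" "p \<in> P" if "p \<in> gens x" for p using that norm_gt_1[of p] by (auto simp: gens_def)
    have xp: "x / real (N p) \<in> X" "x / real (N p) > 0" if "p \<in> gens x" for p
      using divide_norm_in_X[OF xX, of "{#p#}"] Np[OF that] x by auto
    have xS: "(\<Sum>p\<in>gens x. x / real (N p)) = x * S"
      by (simp add: S_def recip_sum_def sum_distrib_left)
    have T1_ge: "T1 \<ge> (\<kappa> - \<eta>) * (x * S) - K * (C * x)"
    proof -
      have "(\<kappa> - \<eta>) * (x * S) - K * (C * x) \<le> (\<kappa> - \<eta>) * (x * S) - K * real (card (gens x))"
        using K_nonneg card_elts_le[of x] card_gens_le[of x] x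
        by (intro diff_left_mono mult_left_mono) auto
      also have "\<dots> = (\<Sum>p\<in>gens x. (\<kappa> - \<eta>) * (x / real (N p)) - K)"
        by (simp add: sum_subtractf sum_distrib_left flip: xS)
      also have "\<dots> \<le> (\<Sum>p\<in>gens x. real (card (elts (x / real (N p)))))"
      proof (rule sum_mono)
        fix p assume "p \<in> gens x"
        then show "(\<kappa> - \<eta>) * (x / real (N p)) - K \<le> real (card (elts (x / real (N p))))"
          using K[OF xp] by (simp add: algebra_simps abs_le_iff diff_divide_distrib)
      qed
      finally show ?thesis by (simp add: T1_def sum_omega)
    qed
    have T1_le: "T1 \<le> C * (x * S)"
    proof -
      have "T1 \<le> (\<Sum>p\<in>gens x. C * (x / real (N p)))"
        unfolding T1_def sum_omega using xp(2) by (intro sum_mono card_elts_le) (simp add: less_imp_le)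
      then show ?thesis by (simp add: sum_distrib_left flip: xS)
    qed
    have T2_le: "T2 \<le> T1 + ((\<kappa> + \<eta>) * (x * S * S) + K * T1)"
    proof -
      \<comment> \<open>The constant \<open>K\<close> is charged only for pairs with \<open>N p * N r \<le> x\<close>. Such pairs number at most \<open>T1\<close>, whereas all pairs of generators up to \<open>x\<close> would be too many.\<close>
      have "(\<Sum>p\<in>gens x. \<Sum>r\<in>gens x. real (card (elts (x / real (N p) / real (N r)))))
          \<le> (\<Sum>p\<in>gens x. \<Sum>r\<in>gens x. (\<kappa> + \<eta>) * (x / real (N p) * (1 / real (N r))) +
               K * of_bool (r \<in> gens (x / real (N p))))"
      proof (intro sum_mono)
        fix p r assume pr: "p \<in> gens x" "r \<in> gens x"
        let ?y = "x / real (N p) / real (N r)"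
        have y: "?y \<in> X" "?y > 0"
          using divide_norm_in_X[OF xp(1)[OF pr(1)], of "{#r#}"] Np[OF pr(1)] Np[OF pr(2)] x by auto
        show "real (card (elts ?y)) \<le> (\<kappa> + \<eta>) * (x / real (N p) * (1 / real (N r))) +
               K * of_bool (r \<in> gens (x / real (N p)))"
        proof (cases "r \<in> gens (x / real (N p))")
          case True
          then show ?thesis using K[OF y] by (simp add: algebra_simps abs_le_iff add_divide_distrib)
        next
          case False
          then have "?y < 1" using Np[OF pr(1)] Np[OF pr(2)] by (auto simp: gens_def field_simps)
          then have "card (elts ?y) = 0" by (simp add: elts_empty)
          moreover have "(\<kappa> + \<eta>) * ?y \<ge> 0" using \<kappa>_pos \<eta> y(2) by (intro mult_nonneg_nonneg) auto
          ultimately show ?thesis using False by simp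
        qed
      qed
      also have "\<dots> = (\<kappa> + \<eta>) * (x * S * S) + K * (\<Sum>p\<in>gens x. \<Sum>r\<in>gens x. of_bool (r \<in> gens (x / real (N p))))"
      proof -
        have "x * S * S = (\<Sum>p\<in>gens x. \<Sum>r\<in>gens x. x / real (N p) * (1 / real (N r)))"
          unfolding xS[symmetric] by (simp only: S_def recip_sum_def sum_product)
        then show ?thesis by (simp only: sum.distrib sum_distrib_left)
      qed
      also have "\<dots> \<le> (\<kappa> + \<eta>) * (x * S * S) + K * T1"
      proof (intro add_left_mono mult_left_mono K_nonneg)
        have "(\<Sum>r\<in>gens x. of_bool (r \<in> gens (x / real (N p)))) \<le> real (card (elts (x / real (N p))))" for p
        proof -
          have "(\<Sum>r\<in>gens x. of_bool (r \<in> gens (x / real (N p)))) = real (card (gens x \<inter> gens (x / real (N p))))"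
            using finite_gens by (simp add: of_bool_def sum.If_cases Int_def)
          also have "\<dots> \<le> real (card (gens (x / real (N p))))"
            by (intro of_nat_mono card_mono finite_gens) auto
          also have "\<dots> \<le> real (card (elts (x / real (N p))))" by (intro of_nat_mono card_gens_le)
          finally show ?thesis .
        qed
        then show "(\<Sum>p\<in>gens x. \<Sum>r\<in>gens x. of_bool (r \<in> gens (x / real (N p)))) \<le> T1"
          unfolding T1_def sum_omega by (intro sum_mono)
      qed
      finally show ?thesis using sum_omega_square_le[of x] by (simp add: T1_def T2_def)
    qed
    have A_le: "A \<le> (\<kappa> + \<eta>) * x + K" using K[OF xX] x by (simp add: A_def abs_le_iff algebra_simps)
    have "(\<Sum>m\<in>elts x. (real (omega m) - S)\<^sup>2) = T2 - 2 * S * T1 + S * S * A"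
      by (simp add: T1_def T2_def A_def power2_diff sum.distrib sum_subtractf sum_distrib_left
          power2_eq_square algebra_simps)
    also have "\<dots> \<le> (C * (x * S) + ((\<kappa> + \<eta>) * (x * S * S) + K * (C * (x * S)))) -
        2 * S * ((\<kappa> - \<eta>) * (x * S) - K * (C * x)) + S * S * ((\<kappa> + \<eta>) * x + K)"
    proof (intro add_mono diff_mono mult_left_mono T1_ge A_le)
      have "K * T1 \<le> K * (C * (x * S))" by (intro mult_left_mono T1_le K_nonneg)
      with T2_le T1_le show "T2 \<le> C * (x * S) + ((\<kappa> + \<eta>) * (x * S * S) + K * (C * (x * S)))" by linarith
    qed (use S0 in auto)
    also have "\<dots> = 4 * \<eta> * (x * S * S) + ((1 + 3 * K) * C) * (x * S) + K * (S * S)"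
      by (simp add: algebra_simps)
    also have "\<dots> \<le> 4 * \<eta> * (x * S * S) + (\<eta> * S) * (x * S) + (\<eta> * x) * (S * S)"
      using S_big x S0 \<eta> unfolding S_def[symmetric]
      by (intro add_mono mult_right_mono) (auto simp: field_simps)
    also have "\<dots> = \<delta> * x * S\<^sup>2" by (simp add: \<eta>_def power2_eq_square)
    finally show ?thesis by (simp add: S_def)
  qed
  have "eventually (\<lambda>x. x \<ge> 1 \<and> x \<ge> K / \<eta> \<and> recip_sum x \<ge> (1 + 3 * K) * C / \<eta>) at_top"
    using filterlim_recip_sum by (intro eventually_conj eventually_ge_at_top) (simp add: filterlim_at_top)
  then have "eventually (\<lambda>x. x \<in> X \<longrightarrow> (\<Sum>m\<in>elts x. (real (omega m) - recip_sum x)\<^sup>2) \<le> \<delta> * x * (recip_sum x)\<^sup>2) at_top"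
    by eventually_elim (use bound in auto)
  then show ?thesis by (simp add: at_top_in_def eventually_inf_principal)
qed

section \<open>Almost all elements have about \<open>ln (ln x)\<close> prime factors\<close>

definition atypical :: "real \<Rightarrow> real \<Rightarrow> 'a multiset set" where
  "atypical \<epsilon> x = {m \<in> elts x.
     \<not> ((1 - \<epsilon>) * ln (ln (real (mnorm N m))) \<le> real (omega m) \<and>
        real (omega m) \<le> (1 + \<epsilon>) * ln (ln (real (mnorm N m))))}"

text \<open>Chebyshev's inequality.\<close>

lemma card_far_le:
  assumes "t > 0"
  shows "real (card {m \<in> elts x. \<bar>real (omega m) - s\<bar> \<ge> t}) * t\<^sup>2
    \<le> (\<Sum>m\<in>elts x. (real (omega m) - s)\<^sup>2)"
proof -
  have "real (card {m \<in> elts x. \<bar>real (omega m) - s\<bar> \<ge> t}) * t\<^sup>2 =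
      (\<Sum>m\<in>{m \<in> elts x. \<bar>real (omega m) - s\<bar> \<ge> t}. t\<^sup>2)"
    by simp
  also have "\<dots> \<le> (\<Sum>m\<in>{m \<in> elts x. \<bar>real (omega m) - s\<bar> \<ge> t}. (real (omega m) - s)\<^sup>2)"
    using assms by (intro sum_mono) (auto simp: abs_le_square_iff[symmetric])
  also have "\<dots> \<le> (\<Sum>m\<in>elts x. (real (omega m) - s)\<^sup>2)"
    by (intro sum_mono2 finite_elts) auto
  finally show ?thesis .
qed

text \<open>If \<open>N(m) > sqrt x\<close>, then \<open>ln (ln (N(m)))\<close> differs from \<open>ln (ln x)\<close> by at most \<open>ln 2\<close>, and
  \<open>recip_sum x\<close> is asymptotic to the same quantity.  Both discrepancies are made small
  against \<open>\<epsilon>\<close>, so that a deviation of \<open>omega m\<close> from \<open>ln (ln (N(m)))\<close> by the factor \<open>\<epsilon>\<close>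
  implies a deviation from \<open>recip_sum x\<close> by the factor \<open>\<epsilon> / 4\<close>.\<close>

lemma atypical_subset:
  assumes \<epsilon>: "\<epsilon> > 0"
  shows "eventually (\<lambda>x. atypical \<epsilon> x \<subseteq> elts (sqrt x) \<union>
    {m \<in> elts x. \<bar>real (omega m) - recip_sum x\<bar> \<ge> \<epsilon> / 4 * recip_sum x}) at_top"
proof -
  define \<rho> where "\<rho> = min \<epsilon> 1 / 8"
  have \<rho>: "\<rho> > 0" "\<rho> \<le> \<epsilon> / 8" "\<rho> \<le> 1 / 8" using \<epsilon> by (auto simp: \<rho>_def)
  have "filterlim (\<lambda>x::real. ln (ln x)) at_top at_top"
    by (rule filterlim_compose[OF ln_at_top ln_at_top])
  then have "eventually (\<lambda>x::real. ln (ln x) \<ge> ln 2 / \<rho>) at_top" "eventually (\<lambda>x::real. ln (ln x) \<ge> 1) at_top"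
    by (simp_all add: filterlim_at_top)
  moreover note eventually_recip_sum_between[OF \<rho>(1)] eventually_gt_at_top[of "1::real"]
  ultimately show ?thesis
  proof eventually_elim
    case (elim x)
    show ?case
    proof
      fix m assume m: "m \<in> atypical \<epsilon> x"
      define L where "L = ln (ln x)"
      define l where "l = ln (ln (real (mnorm N m)))"
      define S where "S = recip_sum x"
      have mx: "m \<in> elts x" using m by (simp add: atypical_def)
      show "m \<in> elts (sqrt x) \<union> {m \<in> elts x. \<bar>real (omega m) - recip_sum x\<bar> \<ge> \<epsilon> / 4 * recip_sum x}"
      proof (cases "m \<in> elts (sqrt x)")
        case False
        have lx: "ln x > 0" using elim(4) by simp
        have sq: "1 < sqrt x" using elim(4) by simp
        have big: "sqrt x < real (mnorm N m)" and small: "real (mnorm N m) \<le> x"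
          using False mx by (auto simp: elts_def)
        have n1: "real (mnorm N m) > 1" using big sq by linarith
        have "ln (sqrt x) \<le> ln (real (mnorm N m))" using big sq n1 by (subst ln_le_cancel_iff) auto
        then have "ln x / 2 \<le> ln (real (mnorm N m))" using elim(4) by (simp add: ln_sqrt)
        then have "ln (ln x / 2) \<le> l" unfolding l_def using lx n1 by (subst ln_le_cancel_iff) auto
        then have l1: "L - ln 2 \<le> l" using lx by (simp add: L_def ln_div)
        have "ln (real (mnorm N m)) \<le> ln x" using small n1 by (subst ln_le_cancel_iff) auto
        then have l2: "l \<le> L" unfolding l_def L_def using lx n1 by (subst ln_le_cancel_iff) auto
        have L1: "L \<ge> 1" using elim(2) by (simp add: L_def)
        have "ln 2 \<le> \<rho> * L" using elim(1) \<rho> by (simp add: L_def field_simps)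
        then have l3: "(1 - \<rho>) * L \<le> l" using l1 by (simp add: algebra_simps)
        have S: "(1 - \<rho>) * L \<le> S" "S \<le> (1 + \<rho>) * L" using elim(3) by (auto simp: S_def L_def)
        have b: "\<bar>real (omega m) - l\<bar> > \<epsilon> * l"
          using m by (auto simp: atypical_def l_def[symmetric] algebra_simps)
        have \<rho>L: "\<rho> * L \<le> \<epsilon> / 8 * L" "\<rho> * L \<le> 1 / 8 * L" using \<rho> L1 by (intro mult_right_mono; simp)+
        have "l - S \<le> \<epsilon> / 4 * L" "S - l \<le> \<epsilon> / 4 * L" using l2 l3 S \<rho>L by (simp_all add: algebra_simps)
        then have "\<bar>l - S\<bar> \<le> \<epsilon> / 4 * L" by linarith
        moreover have "\<epsilon> * (7 / 8 * L) \<le> \<epsilon> * l"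
          using l3 \<rho>L \<epsilon> by (intro mult_left_mono) (auto simp: algebra_simps)
        moreover have "\<epsilon> / 4 * S \<le> \<epsilon> / 4 * (9 / 8 * L)"
          using S \<rho>L \<epsilon> by (intro mult_left_mono) (auto simp: algebra_simps)
        moreover have "\<bar>real (omega m) - l\<bar> \<le> \<bar>real (omega m) - S\<bar> + \<bar>l - S\<bar>" by linarith
        moreover have "\<epsilon> * L > 0" using \<epsilon> L1 by simp
        ultimately have "\<bar>real (omega m) - S\<bar> \<ge> \<epsilon> / 4 * S" using b by (simp add: algebra_simps)
        then show ?thesis using mx by (simp add: S_def)
      qed simp
    qed
  qed
qed

lemma atypical_negligible:
  assumes \<epsilon>: "\<epsilon> > 0" and \<delta>: "\<delta> > 0"
  shows "eventually (\<lambda>x. real (card (atypical \<epsilon> x)) \<le> \<delta> * x) (at_top_in X)"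
proof -
  define \<eta> where "\<eta> = \<delta> / 2 * (\<epsilon> / 4)\<^sup>2"
  have \<eta>: "\<eta> > 0" using \<epsilon> \<delta> by (simp add: \<eta>_def)
  have le: "at_top_in X \<le> at_top" by (simp add: at_top_in_def)
  have "eventually (\<lambda>x. x \<ge> (2 * C / \<delta>)\<^sup>2) at_top" "eventually (\<lambda>x::real. x > 0) at_top"
    "eventually (\<lambda>x. recip_sum x \<ge> 1) at_top"
    using filterlim_recip_sum eventually_ge_at_top eventually_gt_at_top by (auto simp: filterlim_at_top)
  then have "eventually (\<lambda>x. x \<ge> (2 * C / \<delta>)\<^sup>2) (at_top_in X)" "eventually (\<lambda>x. x > 0) (at_top_in X)"
    "eventually (\<lambda>x. recip_sum x \<ge> 1) (at_top_in X)"
    using le filter_leD by blast+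
  moreover note filter_leD[OF le atypical_subset[OF \<epsilon>]] eventually_variance_le[OF \<eta>]
  ultimately show ?thesis
  proof eventually_elim
    case (elim x)
    define S where "S = recip_sum x"
    define F where "F = {m \<in> elts x. \<bar>real (omega m) - S\<bar> \<ge> \<epsilon> / 4 * S}"
    have t: "\<epsilon> / 4 * S > 0" using elim(3) \<epsilon> by (simp add: S_def)
    have "real (card F) * (\<epsilon> / 4 * S)\<^sup>2 \<le> (\<Sum>m\<in>elts x. (real (omega m) - S)\<^sup>2)"
      unfolding F_def by (rule card_far_le[OF t])
    also have "\<dots> \<le> \<eta> * x * S\<^sup>2" using elim(5) by (simp add: S_def)
    also have "\<dots> = \<delta> / 2 * x * (\<epsilon> / 4 * S)\<^sup>2" by (simp add: \<eta>_def power2_eq_square)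
    finally have F_le: "real (card F) \<le> \<delta> / 2 * x" using t by (subst (asm) mult_le_cancel_right) auto
    have "2 * C / \<delta> \<le> sqrt x" by (rule real_le_rsqrt[OF elim(1)])
    then have "C \<le> \<delta> / 2 * sqrt x" using \<delta> by (simp add: field_simps)
    then have "C * sqrt x \<le> \<delta> / 2 * sqrt x * sqrt x" using elim(2) by (intro mult_right_mono) auto
    then have "C * sqrt x \<le> \<delta> / 2 * x" using elim(2) by (simp add: mult.assoc)
    moreover have "real (card (elts (sqrt x))) \<le> C * sqrt x" using elim(2) by (intro card_elts_le) auto
    moreover have "card (atypical \<epsilon> x) \<le> card (elts (sqrt x) \<union> F)"
      using elim(4) finite_elts by (intro card_mono) (auto simp: F_def S_def)
    moreover have "card (elts (sqrt x) \<union> F) \<le> card (elts (sqrt x)) + card F" by (rule card_Un_le)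
    ultimately show ?case using F_le by linarith
  qed
qed

end

section \<open>Growth constants from the asymptotic formula along \<open>X\<close>\<close>

text \<open>The counting function is controlled only at points of \<open>X\<close>.  As every real \<open>y \<ge> 1\<close> has a
  member of \<open>X\<close> within a factor \<open>b\<close> on either side of it (apart from small \<open>y\<close>),
  monotonicity carries linear bounds over to all real arguments, at the price of worse
  constants.  An infinite \<open>elts x\<close> would make all later cardinalities \<open>0\<close>, against \<open>\<kappa> > 0\<close>.\<close>

lemma (in normed_free_monoid) asymptotic_growthI:
  fixes X :: "real set" and \<kappa> b :: real
  assumes \<kappa>: "\<kappa> > 0" and b: "b \<ge> 1"
    and dense: "\<And>y. y \<ge> 1 \<Longrightarrow> \<exists>x\<in>X. y \<le> x \<and> x \<le> b * y"
    and div: "\<And>x m. x \<in> X \<Longrightarrow> m \<in> free_monoid P \<Longrightarrow> x / real (mnorm N m) \<in> X"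
    and lim: "((\<lambda>x. real (card (elts x)) / x) \<longlongrightarrow> \<kappa>) (at_top_in X)"
  obtains c C where "asymptotic_growth P N c C X \<kappa>"
proof -
  have approx: "\<exists>x0\<ge>1. \<forall>x\<in>X. x \<ge> x0 \<longrightarrow> \<bar>real (card (elts x)) - \<kappa> * x\<bar> < \<eta> * x" if \<eta>: "\<eta> > 0" for \<eta>
  proof -
    obtain x0 where x0: "\<forall>x\<in>X. x \<ge> x0 \<longrightarrow> \<bar>real (card (elts x)) / x - \<kappa>\<bar> < \<eta>"
      using tendstoD[OF lim \<eta>] by (auto simp: eventually_at_top_in dist_real_def)
    show ?thesis
    proof (intro exI[of _ "max x0 1"] conjI ballI impI)
      fix x assume x: "x \<in> X" "max x0 1 \<le> x"
      have "\<bar>real (card (elts x)) - \<kappa> * x\<bar> = \<bar>real (card (elts x)) / x - \<kappa>\<bar> * x"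
        using x by (simp add: abs_mult_pos left_diff_distrib)
      also have "\<dots> < \<eta> * x" using x x0 by (intro mult_strict_right_mono) auto
      finally show "\<bar>real (card (elts x)) - \<kappa> * x\<bar> < \<eta> * x" .
    qed auto
  qed
  obtain x0 where x0: "x0 \<ge> 1"
    and half: "\<And>x. x \<in> X \<Longrightarrow> x \<ge> x0 \<Longrightarrow> \<bar>real (card (elts x)) - \<kappa> * x\<bar> < \<kappa> / 2 * x"
    using approx[of "\<kappa> / 2"] \<kappa> by auto
  have lower: "\<kappa> / 2 * x \<le> real (card (elts x))" and upper: "real (card (elts x)) \<le> 2 * \<kappa> * x"
    if "x \<in> X" "x \<ge> x0" for x
  proof -
    have "\<kappa> * x > 0" using \<kappa> that x0 by simp
    moreover have "real (card (elts x)) - \<kappa> * x < \<kappa> / 2 * x" "\<kappa> * x - real (card (elts x)) < \<kappa> / 2 * x"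
      using half[OF that] by linarith+
    ultimately show "\<kappa> / 2 * x \<le> real (card (elts x))" "real (card (elts x)) \<le> 2 * \<kappa> * x"
      by simp_all
  qed
  have fin: "finite (elts x)" for x
  proof -
    obtain y where y: "y \<in> X" "max x x0 \<le> y" using dense[of "max x x0"] x0 by (auto simp: le_max_iff_disj)
    have "\<kappa> / 2 * y > 0" using \<kappa> x0 y by simp
    with lower[of y] y have "card (elts y) > 0" by simp
    then have "finite (elts y)" by (simp add: card_gt_0_iff)
    then show ?thesis using elts_mono[of x y] y finite_subset by auto
  qed
  define c where "c = min (\<kappa> / (2 * b)) (1 / (b * x0))"
  define C where "C = 2 * \<kappa> * (b * x0)"
  show ?thesis
  proof (rule that[of c C], unfold_locales)
    show "c > 0" using \<kappa> b x0 by (simp add: c_def)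
    show "finite (elts x)" for x by (rule fin)
    show "c * y \<le> real (card (elts y))" if y: "y \<ge> 1" for y
    proof (cases "y \<ge> b * x0")
      case True
      then have "y / b \<ge> x0" using b by (simp add: field_simps)
      moreover obtain x where x: "x \<in> X" "y / b \<le> x" "x \<le> b * (y / b)"
        using dense[of "y / b"] calculation x0 by force
      ultimately have "\<kappa> / 2 * x \<le> real (card (elts x))" using lower by simp
      also have "\<dots> \<le> real (card (elts y))"
        using x b by (intro of_nat_mono card_mono fin elts_mono) simp
      finally have "\<kappa> / 2 * x \<le> real (card (elts y))" .
      moreover have "c * y \<le> \<kappa> / (2 * b) * y" using y by (intro mult_right_mono) (auto simp: c_def)
      moreover have "\<kappa> / (2 * b) * y = \<kappa> / 2 * (y / b)" by simp
      moreover have "\<kappa> / 2 * (y / b) \<le> \<kappa> / 2 * x" using x \<kappa> by (intro mult_left_mono) auto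
      ultimately show ?thesis by linarith
    next
      case False
      have "c * y \<le> 1 / (b * x0) * y" using y by (intro mult_right_mono) (auto simp: c_def)
      also have "\<dots> \<le> 1" using False b x0 by (simp add: field_simps)
      also have "1 \<le> real (card (elts y))"
        using empty_in_elts[OF y] fin[of y] by (auto simp: Suc_le_eq card_gt_0_iff)
      finally show ?thesis .
    qed
    show "real (card (elts y)) \<le> C * y" if y: "y \<ge> 0" for y
    proof (cases "y < 1")
      case True
      then show ?thesis using y \<kappa> b x0 by (simp add: elts_empty C_def)
    next
      case False
      obtain x where x: "x \<in> X" "max y x0 \<le> x" "x \<le> b * max y x0" using dense[of "max y x0"] x0 by (auto simp: le_max_iff_disj)
      have "y * 1 \<le> y * x0" "1 * x0 \<le> y * x0" using False x0 by (intro mult_left_mono mult_right_mono; simp)+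
      then have "max y x0 \<le> y * x0" by simp
      then have "b * max y x0 \<le> b * (y * x0)" using b by (intro mult_left_mono) auto
      with x have xle: "x \<le> b * (y * x0)" by linarith
      have "real (card (elts y)) \<le> real (card (elts x))" using x by (intro of_nat_mono card_mono fin elts_mono) auto
      also have "\<dots> \<le> 2 * \<kappa> * x" using x by (intro upper) auto
      also have "\<dots> \<le> 2 * \<kappa> * (b * (y * x0))" using xle \<kappa> by (intro mult_left_mono) auto
      finally show ?thesis by (simp add: C_def mult_ac)
    qed
    show "\<kappa> > 0" by (rule \<kappa>)
    show "x / real (mnorm N m) \<in> X" if "x \<in> X" "m \<in> free_monoid P" for x m using div that .
    show "\<exists>K. \<forall>x\<in>X. x > 0 \<longrightarrow> \<bar>real (card (elts x)) - \<kappa> * x\<bar> \<le> \<eta> * x + K" if \<eta>: "\<eta> > 0" for \<eta>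
    proof -
      obtain x1 where x1: "x1 \<ge> 1" "\<And>x. x \<in> X \<Longrightarrow> x \<ge> x1 \<Longrightarrow> \<bar>real (card (elts x)) - \<kappa> * x\<bar> < \<eta> * x"
        using approx[OF \<eta>] by auto
      define K where "K = real (card (elts x1)) + \<kappa> * x1"
      have K0: "K \<ge> 0" using \<kappa> x1 by (simp add: K_def)
      have "\<bar>real (card (elts x)) - \<kappa> * x\<bar> \<le> \<eta> * x + K" if x: "x \<in> X" "x > 0" for x
      proof (cases "x \<ge> x1")
        case True
        with x1(2)[OF x(1)] K0 show ?thesis by simp
      next
        case False
        then have "card (elts x) \<le> card (elts x1)" by (intro card_mono fin elts_mono) auto
        moreover have "\<kappa> * x \<le> \<kappa> * x1" "\<kappa> * x \<ge> 0" "\<eta> * x \<ge> 0" "\<kappa> * x1 \<ge> 0"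
          using False \<kappa> \<eta> x x1 by (auto intro: mult_left_mono)
        ultimately show ?thesis by (simp add: K_def abs_le_iff)
      qed
      then show ?thesis by blast
    qed
  qed
qed

lemma norm_range_cofinal:
  assumes "X = \<rat> \<or> (\<exists>q::nat. q > 1 \<and> X = {real q powi z | z :: int. True})"
  obtains b where "b \<ge> 1" "\<And>y. y \<ge> 1 \<Longrightarrow> \<exists>x\<in>X. y \<le> x \<and> x \<le> b * y"
  using assms
proof (elim disjE exE conjE)
  assume X: "X = \<rat>"
  show ?thesis
  proof (rule that[of 2])
    fix y :: real assume y: "y \<ge> 1"
    show "\<exists>x\<in>X. y \<le> x \<and> x \<le> 2 * y"
    proof (rule bexI[of _ "of_int \<lceil>y\<rceil>"])
      show "y \<le> of_int \<lceil>y\<rceil> \<and> of_int \<lceil>y\<rceil> \<le> 2 * y" using y by linarith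
    qed (simp add: X)
  qed simp
next
  fix q :: nat assume q: "q > 1" and X: "X = {real q powi z | z :: int. True}"
  show ?thesis
  proof (rule that[of "real q"])
    show "real q \<ge> 1" using q by simp
    fix y :: real assume y: "y \<ge> 1"
    define z where "z = \<lceil>log (real q) y\<rceil>"
    have z: "log (real q) y \<le> of_int z" "of_int z \<le> log (real q) y + 1" unfolding z_def by linarith+
    have eq: "real q powi z = real q powr of_int z" using q by (simp add: powr_real_of_int')
    have "y = real q powr log (real q) y" using q y by simp
    also have "\<dots> \<le> real q powi z" unfolding eq using z q by (intro powr_mono) auto
    finally have "y \<le> real q powi z" .
    moreover have "real q powi z \<le> real q powr (log (real q) y + 1)" unfolding eq using z q by (intro powr_mono) auto
    then have "real q powi z \<le> real q * y" using q y by (simp add: powr_add mult.commute)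
    ultimately show "\<exists>x\<in>X. y \<le> x \<and> x \<le> real q * y" using X by blast
  qed
qed

lemma norm_range_divide:
  assumes "X = \<rat> \<or> (\<exists>q::nat. q > 1 \<and> X = {real q powi z | z :: int. True})"
    and "x \<in> X" "y \<in> X"
  shows "x / y \<in> X"
  using assms
proof (elim disjE exE conjE)
  fix q :: nat assume q: "q > 1" and X: "X = {real q powi z | z :: int. True}"
  from X assms obtain z w where "x = real q powi z" "y = real q powi w" by blast
  then have "x / y = real q powi (z - w)" using q by (simp add: power_int_diff)
  with X show ?thesis by blast
qed simp

section \<open>The normal order of \<open>omega\<close> on the \<open>h\<close>-free elements\<close>

theorem corollary1p1:
  fixes P :: "'a set" and N :: "'a \<Rightarrow> nat" and X :: "real set"
    and \<kappa> \<theta> \<epsilon> :: real and h :: nat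
  assumes "countable P"
    and "\<And>p. p \<in> P \<Longrightarrow> N p > 1"
    and "X = \<rat> \<or> (\<exists>q::nat. q > 1 \<and> X = {real q powi z | z :: int. True})"
    and "\<And>m. m \<in> free_monoid P \<Longrightarrow> real (mnorm N m) \<in> X"
    and "\<kappa> > 0" and "0 \<le> \<theta>" and "\<theta> < 1"
    and "(\<lambda>x. real (card {m \<in> free_monoid P. real (mnorm N m) \<le> x}) - \<kappa> * x)
           \<in> O[at_top_in X](\<lambda>x. x powr \<theta>)"
    and "h \<ge> 2"
    and "\<epsilon> > 0"
  shows "(\<lambda>x. real (card {m \<in> h_free_upto P N h x. m \<noteq> {#} \<and>
             \<not> ((1 - \<epsilon>) * ln (ln (real (mnorm N m))) \<le> real (omega m) \<and>
                real (omega m) \<le> (1 + \<epsilon>) * ln (ln (real (mnorm N m))))}))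
           \<in> o[at_top_in X](\<lambda>x. real (card (h_free_upto P N h x)))"
proof -
  have le: "at_top_in X \<le> at_top" by (simp add: at_top_in_def)
  interpret normed_free_monoid P N using assms(2) by unfold_locales
  obtain b where b: "b \<ge> 1" "\<And>y. y \<ge> 1 \<Longrightarrow> \<exists>x\<in>X. y \<le> x \<and> x \<le> b * y"
    using norm_range_cofinal[OF assms(3)] by blast
  have pos: "eventually (\<lambda>x. x \<ge> 1) (at_top_in X)"
    using filter_leD[OF le eventually_ge_at_top[of "1::real"]] .
  have "(\<lambda>x::real. x powr \<theta>) \<in> o(\<lambda>x. x powr 1)"
    using \<open>\<theta> < 1\<close> by (subst powr_smallo_iff[OF filterlim_ident]) auto
  also have "(\<lambda>x::real. x powr 1) \<in> O(\<lambda>x. x)"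
    by (intro bigoI[of _ 1] eventually_mono[OF eventually_gt_at_top[of 0]]) auto
  finally have "(\<lambda>x::real. x powr \<theta>) \<in> o[at_top_in X](\<lambda>x. x)"
    by (rule landau_o.small.filter_mono[OF le])
  with assms(8) have "(\<lambda>x. real (card (elts x)) - \<kappa> * x) \<in> o[at_top_in X](\<lambda>x. x)"
    unfolding elts_def by (rule landau_o.big_small_trans)
  then have "((\<lambda>x. (real (card (elts x)) - \<kappa> * x) / x) \<longlongrightarrow> 0) (at_top_in X)"
    by (rule smalloD_tendsto)
  from tendsto_add[OF this tendsto_const[of \<kappa>]]
  have "((\<lambda>x. (real (card (elts x)) - \<kappa> * x) / x + \<kappa>) \<longlongrightarrow> \<kappa>) (at_top_in X)" by simp
  then have lim: "((\<lambda>x. real (card (elts x)) / x) \<longlongrightarrow> \<kappa>) (at_top_in X)"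
    by (rule Lim_transform_eventually) (use pos in eventually_elim, simp add: field_simps)
  obtain c C where "asymptotic_growth P N c C X \<kappa>"
    using asymptotic_growthI[OF \<open>\<kappa> > 0\<close> b norm_range_divide[OF assms(3) _ assms(4)] lim] by blast
  then interpret asymptotic_growth P N c C X \<kappa> .
  obtain d where d: "d > 0" "\<And>x. x \<ge> 1 \<Longrightarrow> d * x \<le> real (card (h_free_upto P N h x))"
    using card_h_free_upto_ge[OF \<open>h \<ge> 2\<close>] by blast
  show ?thesis
  proof (rule landau_o.smallI)
    fix e :: real assume e: "e > 0"
    then have "e * d > 0" using d by simp
    from atypical_negligible[OF \<open>\<epsilon> > 0\<close> this] pos
    show "eventually (\<lambda>x. norm (real (card {m \<in> h_free_upto P N h x. m \<noteq> {#} \<and>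
             \<not> ((1 - \<epsilon>) * ln (ln (real (mnorm N m))) \<le> real (omega m) \<and>
                real (omega m) \<le> (1 + \<epsilon>) * ln (ln (real (mnorm N m))))}))
           \<le> e * norm (real (card (h_free_upto P N h x)))) (at_top_in X)" (is "eventually (\<lambda>x. norm (real (card (?B x))) \<le> _ x) _")
    proof eventually_elim
      case (elim x)
      have "finite (atypical \<epsilon> x)" by (rule finite_subset[OF _ finite_elts[of x]]) (auto simp: atypical_def)
      then have "card (?B x) \<le> card (atypical \<epsilon> x)"
        by (rule card_mono) (auto simp: atypical_def h_free_upto_def elts_def)
      then have "real (card (?B x)) \<le> e * d * x" using elim(1) by linarith
      also have "\<dots> \<le> e * real (card (h_free_upto P N h x))"
        using d(2)[OF elim(2)] e by (simp add: mult.assoc)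
      finally show ?case by simp
    qed
  qed
qed

end
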